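(* Let $\mathcal X$ be an arbitrary state space (a measurable space with a fixed reference measure), let $Q$ be a normalized probability density on $\mathcal X$, and let $P=P^*/Z$ be a probability density on $\mathcal X$ with $P^*$ unnormalized and $0<Z=\int P^*(x)\,dx<\infty$. Suppose $Q$ and $P$ have full support over $\mathcal X$ (i.e. $Q>0$ and $P^*>0$ on $\mathcal X$) and $$\mathbb E_{X\sim Q}\!\left[\frac{Q(X)}{P^*(X)}\right]<\infty .$$ Let $N$ be a random nonnegative integer with $\Pr(N\ge i)>0$ for all $i\ge 0$, independent of the proposals drawn. Then the output $S$ of the Rao--Blackwellized Backward Coupled Estimator algorithm (defined in the context) has finite expectation, i.e. $\mathbb E[|S|]<\infty$, and is unbiased for $1/Z$, i.e. $\mathbb E[S]=1/Z$.
   Context: The importance weight is $w(x)=P^*(x)/Q(x)$. Rao--Blackwellized Backward Coupled Estimator algorithm (input $P^*$, $Q$, law of $N$): 1. Draw the random stopping time $N$. 2. Draw $X_{\mathrm{prop}}^{(0)},\dots,X_{\mathrm{prop}}^{(N)}$ i.i.d. from $Q$ and set $w^{(i)}=w(X_{\mathrm{prop}}^{(i)})$. 3. Initialize $S=1/w^{(N)}$ and $Y_{\mathrm{rb}}^{(0)}=1/w^{(N)}$. 4. For $i=1,\dots,N$: (a) Find $k$ with $0\le k<i$ and $w^{(N-k)}=\max_{0\le j<i}w^{(N-j)}$. (b) If $w^{(N-i)}<w^{(N-k)}$, set $Y_{\mathrm{rb}}^{(i)}=Y_{\mathrm{rb}}^{(k)}$. (c) Otherwise initialize $Y_{\mathrm{rb}}^{(i)}=0$,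 $\gamma=1$; for $j=0,\dots,i-1$ update, in this order, $$Y_{\mathrm{rb}}^{(i)}\leftarrow Y_{\mathrm{rb}}^{(i)}+\frac{w^{(N-i+j+1)}}{w^{(N-i)}}\,\gamma\,Y_{\mathrm{rb}}^{(i-j-1)},\qquad \gamma\leftarrow\gamma\left(1-\frac{w^{(N-i+j+1)}}{w^{(N-i)}}\right);$$ after the loop over $j$, set $Y_{\mathrm{rb}}^{(i)}\leftarrow Y_{\mathrm{rb}}^{(i)}+\gamma/w^{(N-i)}$. (d) Update $S\leftarrow S+\dfrac{Y_{\mathrm{rb}}^{(i)}-Y_{\mathrm{rb}}^{(i-1)}}{\Pr(N\ge i)}$. 5. Output $S$. (Equivalently, $Y_{\mathrm{rb}}^{(i)}$ is the conditional expectation, given the proposals, of $1/w$ at the final state of the Metropolis--Hastings chain which starts at $X_{\mathrm{prop}}^{(N-i)}$ and is successively offered the proposals $X_{\mathrm{prop}}^{(N-i+1)},\dots,X_{\mathrm{prop}}^{(N)}$, where a proposal $x'$ at current state $x$ is accepted with probability $\min\{1,w(x')/w(x)\}$.) *)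

theory Defs
  imports "HOL-Probability.Probability"
begin

text \<open>
  Throughout, \<open>n\<close> is the realised value of the stopping time, \<open>w i\<close> is the importance weight of
  the \<open>i\<close>-th proposal (\<open>0 \<le> i \<le> n\<close>) and \<open>Y i\<close> is the \<open>i\<close>-th Rao--Blackwellized value.
\<close>

definition importance_weight :: "('x \<Rightarrow> real) \<Rightarrow> ('x \<Rightarrow> real) \<Rightarrow> 'x \<Rightarrow> real" where
  "importance_weight Pstar Q x = Pstar x / Q x"

text \<open>
  \<open>rb_loop n w Y i m\<close> is the pair (accumulated value of \<open>Y i\<close>, current \<open>\<gamma>\<close>) after the iterations
  \<open>j = 0, \<dots>, m - 1\<close>. For \<open>m \<le> i \<le> n\<close> no natural-number subtraction truncates, and only the
  values of \<open>Y\<close> below \<open>i\<close> are read.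
\<close>

primrec rb_loop ::
  "nat \<Rightarrow> (nat \<Rightarrow> real) \<Rightarrow> (nat \<Rightarrow> real) \<Rightarrow> nat \<Rightarrow> nat \<Rightarrow> real \<times> real" where
  "rb_loop n w Y i 0 = (0, 1)"
| "rb_loop n w Y i (Suc j) =
     (let (y, \<gamma>) = rb_loop n w Y i j;
          r = w (n - i + j + 1) / w (n - i)
      in (y + r * \<gamma> * Y (i - j - 1), \<gamma> * (1 - r)))"

definition rb_fresh_value :: "nat \<Rightarrow> (nat \<Rightarrow> real) \<Rightarrow> (nat \<Rightarrow> real) \<Rightarrow> nat \<Rightarrow> real" where
  "rb_fresh_value n w Y i = (let (y, \<gamma>) = rb_loop n w Y i i in y + \<gamma> / w (n - i))"

text \<open>
  The algorithm asks for some maximising index \<open>k\<close> without saying how ties are broken, so a run is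
  a relation: every choice of maximiser at every step is admitted.
\<close>

definition rb_run :: "nat \<Rightarrow> (nat \<Rightarrow> real) \<Rightarrow> (nat \<Rightarrow> real) \<Rightarrow> bool" where
  "rb_run n w Y \<longleftrightarrow>
     Y 0 = 1 / w n \<and>
     (\<forall>i\<in>{1..n}. \<exists>k<i.
        w (n - k) = Max ((\<lambda>j. w (n - j)) ` {..<i}) \<and>
        Y i = (if w (n - i) < w (n - k) then Y k else rb_fresh_value n w Y i))"

text \<open>
  \<open>tail i\<close> stands for the probability that the stopping time is at least \<open>i\<close>.
\<close>

definition rb_output :: "(nat \<Rightarrow> real) \<Rightarrow> nat \<Rightarrow> (nat \<Rightarrow> real) \<Rightarrow> real \<Rightarrow> bool" where
  "rb_output tail n w s \<longleftrightarrow>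
     (\<exists>Y. rb_run n w Y \<and> s = 1 / w n + (\<Sum>i=1..n. (Y i - Y (i - 1)) / tail i))"

text \<open>
  The library's \<open>indep_var\<close> forces both random variables to have values in the same type, so
  independence of the stopping time and the whole proposal sequence is stated through the
  generated sigma-algebras.
\<close>

definition indep_of_sequence ::
  "'a measure \<Rightarrow> ('a \<Rightarrow> nat) \<Rightarrow> 'x measure \<Rightarrow> (nat \<Rightarrow> 'a \<Rightarrow> 'x) \<Rightarrow> bool" where
  "indep_of_sequence M N \<mu> X \<longleftrightarrow>
     prob_space.indep_set M
       {N -` A \<inter> space M | A. A \<in> sets (count_space UNIV)}
       {(\<lambda>\<omega> i. X i \<omega>) -` B \<inter> space M | B. B \<in> sets (\<Pi>\<^sub>M i\<in>UNIV. \<mu>)}"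

end

theory Submission
  imports Defs
begin

text \<open>
  Read backwards from \<open>N\<close>, the weights \<open>u j = w (N - j)\<close> are i.i.d. and independent of \<open>N\<close>, and the
  \<open>i\<close>-th Rao--Blackwellized value is a function of \<open>u 0, \<dots>, u i\<close> alone: the mean of \<open>1 / w\<close> at the
  end of a Metropolis--Hastings chain started at \<open>u i\<close>. A monotone coupling shows that these values
  are nonincreasing in \<open>i\<close>, so the correction terms of the estimator have constant sign and Tonelli
  gives both integrability and telescoping. It remains to identify the limit of the means. The
  chain started from the target law has mean exactly \<open>1 / Z\<close> at every time, and two chains started
  at weights at most \<open>K\<close> coalesce at a geometric rate depending only on \<open>K\<close>, while \<open>1 / w\<close> at the
  final state never exceeds \<open>1 / u 0\<close>, which absorbs the starting weights above \<open>K\<close>.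
\<close>

section \<open>Pathwise monotonicity of the chain value\<close>

text \<open>
  The conditional mean of \<open>1 / w\<close> at the final state of the chain started at weight \<open>z\<close> and offered
  \<open>u (i - 1), \<dots>, u 0\<close> in this order.
\<close>

primrec mh_value :: "(nat \<Rightarrow> real) \<Rightarrow> nat \<Rightarrow> real \<Rightarrow> real" where
  "mh_value u 0 z = 1 / z"
| "mh_value u (Suc i) z =
     min 1 (u i / z) * mh_value u i (u i) + (1 - min 1 (u i / z)) * mh_value u i z"

lemma mh_value_cong: "(\<And>j. j < i \<Longrightarrow> u j = v j) \<Longrightarrow> mh_value u i z = mh_value v i z"
  by (induction i arbitrary: z) auto

text \<open>The start has to be a function \<open>h\<close> for the induction to go through, since
  an acceptance restarts the recursion at the random weight \<open>U x i\<close>.\<close>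

lemma mh_value_measurable [measurable (raw)]:
  assumes "\<And>j. (\<lambda>x. U x j) \<in> borel_measurable M" "h \<in> borel_measurable M"
  shows "(\<lambda>x. mh_value (U x) i (h x)) \<in> borel_measurable M"
  using assms(2)
proof (induction i arbitrary: h)
  case (Suc i)
  note [measurable] = assms(1) Suc.prems Suc.IH[OF assms(1)] Suc.IH[OF Suc.prems]
  show ?case by simp
qed simp

lemma convex_comb_le:
  fixes a b :: real
  assumes "0 \<le> a" "a \<le> 1" "x \<le> c" "y \<le> c"
  shows "a * x + (1 - a) * y \<le> c"
  using convex_bound_le[of x c y a "1 - a"] assms by simp

lemma mh_value_nonneg:
  assumes "\<And>j. 0 < u j" "0 < z"
  shows "0 \<le> mh_value u i z"
  using assms(2)
proof (induction i arbitrary: z)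
  case (Suc i)
  then show ?case using assms(1)[of i] by (auto intro!: add_nonneg_nonneg mult_nonneg_nonneg)
qed simp

text \<open>Monotone coupling: with a shared uniform variable a lighter state accepts whenever a
  heavier one does, so the two chains keep their order up to the final state, where
  \<open>1 / z\<close> is decreasing.\<close>

lemma mh_value_antimono:
  assumes "\<And>j. 0 < u j" "0 < x" "x \<le> z"
  shows "mh_value u i z \<le> mh_value u i x"
  using assms(2,3)
proof (induction i arbitrary: x z)
  case 0
  then show ?case by (simp add: frac_le)
next
  case (Suc i)
  define f where "f = mh_value u i"
  define y where "y = u i"
  define a b where "a = min 1 (y / z)" and "b = min 1 (y / x)"
  have y: "0 < y" using assms(1) by (simp add: y_def)
  have ab: "a \<le> b" "b \<le> 1"
    using divide_left_mono[of x z y] Suc.prems y by (auto simp: a_def b_def min_le_iff_disj)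
  \<comment> \<open>The gap is split over the events that only the lighter chain accepts
    (probability \<open>b - a\<close>) and that neither does (probability \<open>1 - b\<close>). If
    \<open>y > z\<close>, both accept surely and the first event is null.\<close>
  have "0 \<le> (b - a) * (f y - f z)"
  proof (cases "y \<le> z")
    case True
    then show ?thesis using ab Suc.IH[of y z] y by (simp add: f_def)
  next
    case False
    then show ?thesis using Suc.prems by (simp add: a_def b_def)
  qed
  moreover have "0 \<le> (1 - b) * (f x - f z)"
    using ab Suc.IH[of x z] Suc.prems by (simp add: f_def)
  ultimately show ?case
    by (simp add: f_def[symmetric] y_def[symmetric] a_def[symmetric] b_def[symmetric] algebra_simps)
qed

text \<open>The last offer is \<open>u 0\<close>: either it is accepted, or it is rejected by a
  state heavier than \<open>u 0\<close>. So the final weight is at least \<open>u 0\<close>, which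
  requires at least one offer, hence \<open>Suc i\<close>.\<close>

lemma mh_value_le_inverse:
  assumes "\<And>j. 0 < u j" "0 < z"
  shows "mh_value u (Suc i) z \<le> 1 / u 0"
  using assms(2)
proof (induction i arbitrary: z)
  case 0
  show ?case
  proof (cases "z \<le> u 0")
    case False
    then have "min 1 (u 0 / z) * (1 / u 0) + (1 - min 1 (u 0 / z)) * (1 / z) \<le> 1 / u 0"
      using assms(1)[of 0] 0 by (intro convex_comb_le) (auto simp: frac_le)
    then show ?thesis by simp
  qed (use 0 in simp)
next
  case (Suc i)
  show ?case
    unfolding mh_value.simps(2)[of u "Suc i"]
    using assms(1)[of "Suc i"] Suc.prems by (intro convex_comb_le Suc.IH) auto
qed

text \<open>The longer chain starts at \<open>u (Suc i)\<close> and is offered \<open>u i\<close>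
  first. A lighter start moves to \<open>u i\<close> surely; a heavier one gives a mixture of the
  values at \<open>u i\<close> and at a heavier weight, and the latter is no larger.\<close>

lemma mh_value_decseq_step:
  assumes "\<And>j. 0 < u j"
  shows "mh_value u (Suc i) (u (Suc i)) \<le> mh_value u i (u i)"
proof (cases "u (Suc i) \<le> u i")
  case True
  then show ?thesis using assms[of "Suc i"] by simp
next
  case False
  then show ?thesis
    unfolding mh_value.simps(2)
    using assms[of i] assms[of "Suc i"]
    by (intro convex_comb_le mh_value_antimono assms) auto
qed

section \<open>Loss of memory of the starting weight\<close>

text \<open>
  The monotone coupling of the chains started at \<open>x\<close> and \<open>K\<close> coalesces as soon as the latter
  accepts a proposal; the product is the probability that it rejects all of \<open>u i, \<dots>, u 1\<close>.
\<close>

lemma mh_value_oscillation: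
  assumes "\<And>j. 0 < u j" "0 < x" "x \<le> K"
  shows "mh_value u (Suc i) x
    \<le> mh_value u (Suc i) K + 1 / u 0 * (\<Prod>j<i. 1 - min 1 (u (Suc j) / K))"
  using assms(2,3)
proof (induction i arbitrary: x)
  case 0
  have "mh_value u (Suc 0) x \<le> 1 / u 0" "0 \<le> mh_value u (Suc 0) K"
    using mh_value_le_inverse[of u x 0] mh_value_nonneg[of u K "Suc 0"] assms(1) 0 by auto
  then show ?case unfolding lessThan_0 prod.empty by linarith
next
  case (Suc i)
  define f where "f = mh_value u (Suc i)"
  define y where "y = u (Suc i)"
  define e where "e = 1 / u 0 * (\<Prod>j<i. 1 - min 1 (u (Suc j) / K))"
  define a b where "a = min 1 (y / K)" and "b = min 1 (y / x)"
  have y: "0 < y" using assms(1) by (simp add: y_def)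
  have ab: "a \<le> b" "b \<le> 1"
    using divide_left_mono[of x K y] Suc.prems y by (auto simp: a_def b_def min_le_iff_disj)
  have IH: "f t \<le> f K + e" if "0 < t" "t \<le> K" for t
    using Suc.IH[of t] that unfolding f_def e_def by auto
  \<comment> \<open>The chains stay apart only if the one at \<open>K\<close> rejects. Its rejection
    probability \<open>1 - a\<close> is the sum of \<open>b - a\<close>, where only the lighter
    chain moves, and \<open>1 - b\<close>, where neither does; each part of positive probability
    leaves weights at most \<open>K\<close>, so \<open>e\<close> bounds both.\<close>
  have "(b - a) * (f y - f K) \<le> (b - a) * e"
  proof (cases "y \<le> K")
    case True
    then show ?thesis using ab IH[of y] y by (intro mult_left_mono) auto
  next
    case False
    then show ?thesis using Suc.prems by (simp add: a_def b_def)
  qed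
  moreover have "(1 - b) * (f x - f K) \<le> (1 - b) * e"
    using ab IH[of x] Suc.prems by (intro mult_left_mono) auto
  ultimately have "b * f y + (1 - b) * f x \<le> a * f y + (1 - a) * f K + e * (1 - a)"
    by (simp add: algebra_simps)
  then show ?case
    unfolding mh_value.simps(2)[of u "Suc i"] prod.lessThan_Suc f_def[symmetric]
      y_def[symmetric] a_def[symmetric] b_def[symmetric]
    by (simp add: e_def mult.assoc)
qed

text \<open>Only an overweight \<open>y\<close> costs an extra \<open>1 / u 0\<close>. An overweight
  \<open>x\<close> is harmless, because the value is nonincreasing in the start, and for two starts
  up to \<open>K\<close> comparison with \<open>K\<close> gives the coalescence term.\<close>

lemma mh_value_diff_bound:
  assumes "\<And>j. 0 < u j" "0 < x" "0 < y" "0 < K"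
  shows "mh_value u (Suc i) x \<le> mh_value u (Suc i) y
    + (1 / u 0 * indicator {K<..} y + 1 / u 0 * (\<Prod>j<i. 1 - min 1 (u (Suc j) / K)))"
proof -
  define E where "E = 1 / u 0 * (\<Prod>j<i. 1 - min 1 (u (Suc j) / K))"
  have E: "0 \<le> E"
    unfolding E_def using assms(1)[of 0]
    by (intro mult_nonneg_nonneg prod_nonneg) auto
  have *: "0 \<le> 1 / u 0" using assms(1)[of 0] by simp
  consider "y \<le> K" "x \<le> K" | "y \<le> K" "K < x" | "K < y" by linarith
  then show ?thesis
  proof cases
    case 1
    then have "mh_value u (Suc i) x \<le> mh_value u (Suc i) K + E"
      unfolding E_def by (intro mh_value_oscillation assms)
    also have "mh_value u (Suc i) K \<le> mh_value u (Suc i) y"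
      using 1 assms by (intro mh_value_antimono) auto
    finally show ?thesis using 1 by (simp add: E_def)
  next
    case 2
    then have "mh_value u (Suc i) x \<le> mh_value u (Suc i) y"
      using assms by (intro mh_value_antimono) auto
    then show ?thesis using 2 E unfolding E_def[symmetric] by simp
  next
    case 3
    have "mh_value u (Suc i) x \<le> 1 / u 0" "0 \<le> mh_value u (Suc i) y"
      using mh_value_le_inverse[of u x i] mh_value_nonneg[of u y "Suc i"] assms by auto
    then show ?thesis using 3 E unfolding E_def[symmetric] by (simp del: mh_value.simps)
  qed
qed

section \<open>Identifying the values of the algorithm with chain values\<close>

text \<open>A state lighter than the heaviest later proposal \<open>u k\<close> is certainly replaced there.\<close>

lemma mh_value_absorbed:
  assumes "\<And>j. 0 < u j" "0 < z" "z \<le> u k" "k < i" "\<And>j. \<lbrakk>k < j; j < i\<rbrakk> \<Longrightarrow> u j \<le> u k"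
  shows "mh_value u i z = mh_value u k (u k)"
  using assms(2-5)
proof (induction i arbitrary: z)
  case (Suc i)
  show ?case
  proof (cases "i = k")
    case False
    then have "mh_value u i z = mh_value u k (u k)" "mh_value u i (u i) = mh_value u k (u k)"
      using Suc assms(1)[of i] by auto
    then show ?thesis by (simp add: algebra_simps)
  qed (use Suc in auto)
qed simp

text \<open>After \<open>m\<close> offers, \<open>\<gamma>\<close> is the probability that the chain
  from \<open>u i\<close> has rejected them all, and the accumulated sum is the contribution of the
  paths that have accepted one; the other paths still face \<open>i - m\<close> offers. As
  \<open>u i\<close> dominates those offers, the minimum with 1 in the acceptance probability
  disappears.\<close>

lemma rb_loop_invariant:
  assumes "\<And>j. w (n - j) = u j" "\<And>j. j < i \<Longrightarrow> u j \<le> u i" "\<And>j. 0 < u j"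
    "\<And>j. j < i \<Longrightarrow> Y j = mh_value u j (u j)" "m \<le> i" "i \<le> n"
  shows "fst (rb_loop n w Y i m) + snd (rb_loop n w Y i m) * mh_value u (i - m) (u i)
    = mh_value u i (u i)"
  using assms(5)
proof (induction m)
  case (Suc m)
  define k where "k = i - Suc m"
  have k: "i - m = Suc k" "k < i" using Suc.prems by (auto simp: k_def)
  have "Suc (m + n - i) = n - k" "Suc (m + (n - i)) = n - k" "i - m - 1 = k" using Suc.prems assms(6) by (auto simp: k_def)
  moreover have "min 1 (u k / u i) = u k / u i"
    using assms(2)[of k] assms(3)[of i] k by auto
  ultimately show ?case
    using Suc.IH Suc.prems k assms(1)[of i] assms(1)[of k] assms(4)[of k]
    by (simp add: case_prod_beta Let_def k_def[symmetric] algebra_simps)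
qed simp

text \<open>If a later proposal is strictly heavier than \<open>u i\<close>, the chain is absorbed
  at any maximiser \<open>k\<close>; otherwise \<open>u i\<close> is dominant and the loop computes
  its value. Hence the tie-breaking does not affect \<open>Y\<close>.\<close>

lemma rb_run_eq_mh_value:
  assumes run: "rb_run n w Y" and w: "\<And>j. w (n - j) = u j" and pos: "\<And>j. 0 < u j"
    and "i \<le> n"
  shows "Y i = mh_value u i (u i)"
  using \<open>i \<le> n\<close>
proof (induction i rule: less_induct)
  case (less i)
  show ?case
  proof (cases "i = 0")
    case True
    then show ?thesis using run w[of 0] by (simp add: rb_run_def)
  next
    case False
    then have "i \<in> {1..n}" using less.prems by simp
    then obtain k where k: "k < i" "u k = Max (u ` {..<i})"
      and Y: "Y i = (if u i < u k then Y k else rb_fresh_value n w Y i)"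
      using run unfolding rb_run_def w by blast
    have le: "u j \<le> u k" if "j < i" for j
      using that by (simp add: k(2))
    show ?thesis
    proof (cases "u i < u k")
      case True
      then have "Y i = mh_value u k (u k)" using Y less k by simp
      also have "\<dots> = mh_value u i (u i)"
        using True k le pos by (intro mh_value_absorbed[symmetric]) auto
      finally show ?thesis .
    next
      case False
      then have "u j \<le> u i" if "j < i" for j using le[OF that] by simp
      then have "fst (rb_loop n w Y i i) + snd (rb_loop n w Y i i) * mh_value u (i - i) (u i)
          = mh_value u i (u i)"
        using w pos less by (intro rb_loop_invariant) auto
      then show ?thesis using False Y w[of i]
        by (simp add: rb_fresh_value_def case_prod_beta)
    qed
  qed
qed


section \<open>I.i.d. sequences of weights\<close>

locale weight_law = prob_space L for L :: "real measure" +
  assumes sets_L [measurable_cong]: "sets L = sets borel"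
    and pos: "AE z in L. 0 < z"
begin

abbreviation seq_law :: "(nat \<Rightarrow> real) measure" where
  "seq_law \<equiv> \<Pi>\<^sub>M i\<in>UNIV. L"

lemma space_L [simp]: "space L = UNIV"
  using sets_eq_imp_space_eq[OF sets_L] by simp

lemma prob_space_seq_law: "prob_space seq_law"
  by (intro prob_space_PiM prob_space_axioms)

lemma AE_seq_law_pos: "AE u in seq_law. \<forall>j. 0 < u j"
  by (subst AE_all_countable) (intro allI AE_PiM_component prob_space_axioms pos, simp)

text \<open>Overwriting one coordinate by an independent draw leaves the product law unchanged. This
  serves as Tonelli in a single coordinate of the infinite product.\<close>

lemma nn_integral_seq_law_resample:
  assumes [measurable]: "F \<in> borel_measurable seq_law"
  shows "(\<integral>\<^sup>+u. F u \<partial>seq_law) = (\<integral>\<^sup>+y. \<integral>\<^sup>+u. F (u(i := y)) \<partial>seq_law \<partial>L)"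
proof -
  interpret S: prob_space seq_law by (rule prob_space_seq_law)
  have eq: "distr (L \<Otimes>\<^sub>M seq_law) seq_law (\<lambda>(y, u). u(i := y)) = seq_law"
    using distr_pair_PiM_eq_PiM[of UNIV "\<lambda>_. L" i] prob_space_axioms by simp
  have [measurable]: "(\<lambda>(y, u). u(i := y)) \<in> measurable (L \<Otimes>\<^sub>M seq_law) seq_law"
    using measurable_fun_upd[of UNIV UNIV i snd "L \<Otimes>\<^sub>M seq_law" "\<lambda>_. L" fst]
    by (simp add: case_prod_beta')
  have "(\<integral>\<^sup>+u. F u \<partial>seq_law)
      = (\<integral>\<^sup>+p. F ((\<lambda>(y, u). u(i := y)) p) \<partial>(L \<Otimes>\<^sub>M seq_law))"
    by (subst eq[symmetric], subst nn_integral_distr) auto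
  also have "\<dots> = (\<integral>\<^sup>+y. \<integral>\<^sup>+u. F ((\<lambda>(y, u). u(i := y)) (y, u)) \<partial>seq_law \<partial>L)"
    by (subst S.nn_integral_fst[symmetric]) auto
  finally show ?thesis by simp
qed

section \<open>Mean values of the chain: stationarity and coalescence\<close>

definition mean_value :: "nat \<Rightarrow> real \<Rightarrow> ennreal" where
  "mean_value i z = (\<integral>\<^sup>+u. ennreal (mh_value u i z) \<partial>seq_law)"

lemma mean_value_measurable [measurable]: "mean_value i \<in> borel_measurable borel"
proof -
  interpret S: prob_space seq_law by (rule prob_space_seq_law)
  show ?thesis unfolding mean_value_def[abs_def] by measurable
qed

text \<open>One-step equation of the Markov chain: the first offer \<open>u i\<close> is integrated
  out separately, since the values after \<open>i\<close> further offers do not read coordinate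
  \<open>i\<close>.\<close>

lemma mean_value_Suc:
  assumes "0 < z"
  shows "mean_value (Suc i) z = (\<integral>\<^sup>+y. ennreal (min 1 (y / z)) * mean_value i y
    + ennreal (1 - min 1 (y / z)) * mean_value i z \<partial>L)"
proof -
  have "mean_value (Suc i) z
      = (\<integral>\<^sup>+y. \<integral>\<^sup>+u. ennreal (mh_value (u(i := y)) (Suc i) z) \<partial>seq_law \<partial>L)"
    unfolding mean_value_def by (rule nn_integral_seq_law_resample) measurable
  also have "\<dots> = (\<integral>\<^sup>+y. ennreal (min 1 (y / z)) * mean_value i y
    + ennreal (1 - min 1 (y / z)) * mean_value i z \<partial>L)"
  proof (rule nn_integral_cong_AE, use pos in eventually_elim)
    case (elim y)
    have upd: "mh_value (u(i := y)) i t = mh_value u i t" for u t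
      by (rule mh_value_cong) simp
    have "(\<integral>\<^sup>+u. ennreal (mh_value (u(i := y)) (Suc i) z) \<partial>seq_law)
        = (\<integral>\<^sup>+u. ennreal (min 1 (y / z)) * ennreal (mh_value u i y)
          + ennreal (1 - min 1 (y / z)) * ennreal (mh_value u i z) \<partial>seq_law)"
    proof (rule nn_integral_cong_AE, use AE_seq_law_pos in eventually_elim)
      case (elim u)
      have "0 \<le> mh_value u i y" "0 \<le> mh_value u i z"
        using elim \<open>0 < y\<close> assms by (auto intro: mh_value_nonneg)
      then show ?case
        using \<open>0 < y\<close> assms by (simp add: upd ennreal_plus ennreal_mult)
    qed
    also have "\<dots> = ennreal (min 1 (y / z)) * mean_value i y
        + ennreal (1 - min 1 (y / z)) * mean_value i z"
      unfolding mean_value_def by (subst nn_integral_add) (auto simp: nn_integral_cmult)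
    finally show ?case .
  qed
  finally show ?thesis .
qed

text \<open>
  The density of the target law of the weight with respect to \<open>L\<close> is proportional to \<open>z\<close>, so this
  is invariance of the target; the proof is detailed balance, i.e. the symmetry of \<open>min z y\<close>.
\<close>

lemma nn_integral_weighted_mean_value: "(\<integral>\<^sup>+z. ennreal z * mean_value i z \<partial>L) = 1"
proof (induction i)
  case 0
  interpret S: prob_space seq_law by (rule prob_space_seq_law)
  have "(\<integral>\<^sup>+z. ennreal z * mean_value 0 z \<partial>L) = (\<integral>\<^sup>+z. 1 \<partial>L)"
    by (rule nn_integral_cong_AE, use pos in eventually_elim)
      (simp add: mean_value_def S.emeasure_space_1 ennreal_mult[symmetric])
  then show ?case using emeasure_space_1 by simp
next
  case (Suc i)
  interpret P: pair_sigma_finite L L ..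
  define g where "g = mean_value i"
  have [measurable]: "g \<in> borel_measurable borel" by (simp add: g_def)
  have "(\<integral>\<^sup>+z. ennreal z * mean_value (Suc i) z \<partial>L)
      = (\<integral>\<^sup>+z. \<integral>\<^sup>+y. ennreal (min z y) * g y + ennreal (z - min z y) * g z \<partial>L \<partial>L)"
  proof (rule nn_integral_cong_AE, use pos in eventually_elim)
    case (elim z)
    have "ennreal z * mean_value (Suc i) z = (\<integral>\<^sup>+y. ennreal z * (ennreal (min 1 (y / z)) * g y
        + ennreal (1 - min 1 (y / z)) * g z) \<partial>L)"
      unfolding mean_value_Suc[OF elim] g_def[symmetric]
      by (rule nn_integral_cmult[symmetric]) measurable
    also have "\<dots> = (\<integral>\<^sup>+y. ennreal (min z y) * g y + ennreal (z - min z y) * g z \<partial>L)"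
    proof (rule nn_integral_cong_AE, use pos in eventually_elim)
      case (elim y)
      have m: "z * min 1 (y / z) = min z y" "z * (1 - min 1 (y / z)) = z - min z y"
        using \<open>0 < z\<close> elim by (auto simp: min_def field_simps)
      have "ennreal z * (ennreal (min 1 (y / z)) * g y + ennreal (1 - min 1 (y / z)) * g z)
          = (ennreal z * ennreal (min 1 (y / z))) * g y
            + (ennreal z * ennreal (1 - min 1 (y / z))) * g z"
        by (simp add: distrib_left mult.assoc)
      also have "\<dots> = ennreal (min z y) * g y + ennreal (z - min z y) * g z"
        using \<open>0 < z\<close> elim by (simp add: ennreal_mult[symmetric] m)
      finally show ?case .
    qed
    finally show ?case .
  qed
  also have "\<dots> = (\<integral>\<^sup>+z. \<integral>\<^sup>+y. ennreal (min z y) * g y \<partial>L \<partial>L)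
      + (\<integral>\<^sup>+z. \<integral>\<^sup>+y. ennreal (z - min z y) * g z \<partial>L \<partial>L)"
    by (simp add: nn_integral_add)
  \<comment> \<open>Exchanging the variables turns the accepted mass arriving at \<open>y\<close>
    into accepted mass leaving \<open>z\<close>, which together with the rejected mass
    \<open>z - min z y\<close> adds up to \<open>z\<close>.\<close>
  also have "(\<integral>\<^sup>+z. \<integral>\<^sup>+y. ennreal (min z y) * g y \<partial>L \<partial>L)
      = (\<integral>\<^sup>+z. \<integral>\<^sup>+y. ennreal (min z y) * g z \<partial>L \<partial>L)"
    by (subst P.Fubini') (auto simp: min.commute)
  also have "\<dots> + (\<integral>\<^sup>+z. \<integral>\<^sup>+y. ennreal (z - min z y) * g z \<partial>L \<partial>L)
      = (\<integral>\<^sup>+z. \<integral>\<^sup>+y. ennreal (min z y) * g z + ennreal (z - min z y) * g z \<partial>L \<partial>L)"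
    by (simp add: nn_integral_add)
  also have "\<dots> = (\<integral>\<^sup>+z. \<integral>\<^sup>+y. ennreal z * g z \<partial>L \<partial>L)"
  proof (rule nn_integral_cong_AE, use pos in eventually_elim)
    case (elim z)
    show ?case
    proof (rule nn_integral_cong_AE, use pos in eventually_elim)
      case (elim y)
      then show ?case using \<open>0 < z\<close>
        by (simp add: distrib_right[symmetric] ennreal_plus[symmetric] del: ennreal_plus)
    qed
  qed
  also have "\<dots> = 1"
    using Suc.IH emeasure_space_1 by (simp add: g_def)
  finally show ?case .
qed

text \<open>The start \<open>u i\<close> is an independent draw from \<open>L\<close>, as the value
  itself reads only the coordinates below \<open>i\<close>.\<close>

lemma nn_integral_final_value:
  "(\<integral>\<^sup>+u. ennreal (mh_value u i (u i)) \<partial>seq_law) = (\<integral>\<^sup>+z. mean_value i z \<partial>L)"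
proof -
  have "mh_value (u(i := y)) i y = mh_value u i y" for u y
    by (rule mh_value_cong) simp
  then show ?thesis
    by (subst nn_integral_seq_law_resample[of _ i]) (simp_all add: mean_value_def[abs_def])
qed

text \<open>The product begins at \<open>u 1\<close>, so that it is independent of
  \<open>1 / u 0\<close>; integrating out the last coordinate gives one factor per step. The case
  \<open>i = 0\<close> doubles as the marginal formula for \<open>1 / u 0\<close>.\<close>

lemma nn_integral_rejections:
  "(\<integral>\<^sup>+u. ennreal (1 / u 0 * (\<Prod>j<i. 1 - min 1 (u (Suc j) / K))) \<partial>seq_law)
    = (\<integral>\<^sup>+z. ennreal (1 / z) \<partial>L) * (\<integral>\<^sup>+y. ennreal (1 - min 1 (y / K)) \<partial>L) ^ i"
proof (induction i)
  case 0
  interpret S: prob_space seq_law by (rule prob_space_seq_law)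
  show ?case
    by (subst nn_integral_seq_law_resample[of _ 0]) (simp_all add: S.emeasure_space_1)
next
  case (Suc i)
  define F where "F u = 1 / u 0 * (\<Prod>j<i. 1 - min 1 (u (Suc j) / K))" for u :: "nat \<Rightarrow> real"
  have [measurable]: "F \<in> borel_measurable seq_law" unfolding F_def[abs_def] by measurable
  have split: "1 / u 0 * (\<Prod>j<Suc i. 1 - min 1 (u (Suc j) / K))
      = F u * (1 - min 1 (u (Suc i) / K))" for u :: "nat \<Rightarrow> real"
    by (simp add: F_def)
  have upd: "F (u(Suc i := y)) = F u" for u y
    unfolding F_def by (auto intro!: prod.cong)
  have "(\<integral>\<^sup>+u. ennreal (1 / u 0 * (\<Prod>j<Suc i. 1 - min 1 (u (Suc j) / K))) \<partial>seq_law)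
      = (\<integral>\<^sup>+y. \<integral>\<^sup>+u. ennreal (F u * (1 - min 1 (y / K))) \<partial>seq_law \<partial>L)"
    unfolding split by (subst nn_integral_seq_law_resample[of _ "Suc i"]) (simp_all add: upd)
  also have "\<dots> = (\<integral>\<^sup>+y. (\<integral>\<^sup>+u. ennreal (F u) \<partial>seq_law) * ennreal (1 - min 1 (y / K)) \<partial>L)"
    by (simp add: ennreal_mult'' nn_integral_multc)
  also have "\<dots> = (\<integral>\<^sup>+u. ennreal (F u) \<partial>seq_law) * (\<integral>\<^sup>+y. ennreal (1 - min 1 (y / K)) \<partial>L)"
    by (rule nn_integral_cmult) measurable
  finally show ?case
    using Suc.IH by (simp add: F_def[abs_def] mult_ac)
qed

text \<open>Weights are almost surely positive, so the integrand is almost surely below 1, and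
  strictness survives integration. This is the ratio of the geometric coalescence.\<close>

lemma mean_rejection_less_1:
  assumes "0 < K"
  shows "(\<integral>\<^sup>+y. ennreal (1 - min 1 (y / K)) \<partial>L) < 1"
proof -
  have le: "AE y in L. ennreal (1 - min 1 (y / K)) < 1"
    using pos by eventually_elim (use assms in \<open>auto simp: ennreal_less_one_iff\<close>)
  have le': "AE y in L. ennreal (1 - min 1 (y / K)) \<le> 1"
    using le by eventually_elim simp
  have "(\<integral>\<^sup>+y. ennreal (1 - min 1 (y / K)) \<partial>L) \<le> (\<integral>\<^sup>+y. 1 \<partial>L)"
    by (rule nn_integral_mono_AE[OF le'])
  then have fin: "(\<integral>\<^sup>+y. ennreal (1 - min 1 (y / K)) \<partial>L) \<noteq> \<infinity>"
    using emeasure_space_1 by (auto simp: top_unique)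
  have "\<not> (AE y in L. 1 \<le> ennreal (1 - min 1 (y / K)))"
  proof
    assume "AE y in L. 1 \<le> ennreal (1 - min 1 (y / K))"
    with le have "AE y in L. False" by eventually_elim auto
    then show False by simp
  qed
  then have "(\<integral>\<^sup>+y. ennreal (1 - min 1 (y / K)) \<partial>L) < (\<integral>\<^sup>+y. 1 \<partial>L)"
    using fin le' by (intro nn_integral_less) auto
  then show ?thesis using emeasure_space_1 by simp
qed

text \<open>This averages the pathwise bound; by independence both error terms carry the mean of
  \<open>1 / u 0\<close> as a factor.\<close>

lemma mean_value_diff_bound:
  assumes "0 < x" "0 < y" "0 < K"
  shows "mean_value (Suc i) x \<le> mean_value (Suc i) y
    + (\<integral>\<^sup>+z. ennreal (1 / z) \<partial>L)
      * (indicator {K<..} y + (\<integral>\<^sup>+t. ennreal (1 - min 1 (t / K)) \<partial>L) ^ i)"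
proof -
  define F where "F u = 1 / u 0 * (\<Prod>j<i. 1 - min 1 (u (Suc j) / K))" for u :: "nat \<Rightarrow> real"
  have [measurable]: "F \<in> borel_measurable seq_law" unfolding F_def[abs_def] by measurable
  have inverse: "(\<integral>\<^sup>+u. ennreal (1 / u 0) \<partial>seq_law) = (\<integral>\<^sup>+z. ennreal (1 / z) \<partial>L)"
    using nn_integral_rejections[where i = 0] by simp
  have "mean_value (Suc i) x \<le> (\<integral>\<^sup>+u. ennreal (mh_value u (Suc i) y)
      + (ennreal (1 / u 0) * indicator {K<..} y + ennreal (F u)) \<partial>seq_law)"
    unfolding mean_value_def
  proof (rule nn_integral_mono_AE, use AE_seq_law_pos in eventually_elim)
    case (elim u)
    have nonneg: "0 \<le> mh_value u (Suc i) y" "0 \<le> 1 / u 0 * indicator {K<..} y" "0 \<le> F u"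
      using elim assms less_imp_le[OF elim[rule_format, of 0]]
      by (auto simp: F_def simp del: mh_value.simps
          intro!: mh_value_nonneg mult_nonneg_nonneg divide_nonneg_nonneg prod_nonneg)
    have "mh_value u (Suc i) x \<le> mh_value u (Suc i) y + (1 / u 0 * indicator {K<..} y + F u)"
      using elim assms unfolding F_def by (intro mh_value_diff_bound) auto
    then have "ennreal (mh_value u (Suc i) x)
        \<le> ennreal (mh_value u (Suc i) y + (1 / u 0 * indicator {K<..} y + F u))"
      by (rule ennreal_leI)
    also have "\<dots> = ennreal (mh_value u (Suc i) y)
        + (ennreal (1 / u 0 * indicator {K<..} y) + ennreal (F u))"
      using nonneg by (simp add: ennreal_plus del: mh_value.simps)
    also have "ennreal (1 / u 0 * indicator {K<..} y) = ennreal (1 / u 0) * indicator {K<..} y"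
      by (auto simp: indicator_def)
    finally show ?case .
  qed
  also have "\<dots> = mean_value (Suc i) y
      + ((\<integral>\<^sup>+z. ennreal (1 / z) \<partial>L) * indicator {K<..} y + (\<integral>\<^sup>+u. ennreal (F u) \<partial>seq_law))"
    unfolding mean_value_def
    by (simp add: nn_integral_add nn_integral_multc inverse del: mh_value.simps)
  finally show ?thesis
    by (simp only: F_def[abs_def] nn_integral_rejections distrib_left)
qed

section \<open>Convergence of the means and summation of their decrements\<close>

lemma decseq_mean_final_value: "decseq (\<lambda>i. \<integral>\<^sup>+u. ennreal (mh_value u i (u i)) \<partial>seq_law)"
proof (rule decseq_SucI, rule nn_integral_mono_AE)
  show "AE u in seq_law. ennreal (mh_value u (Suc i) (u (Suc i))) \<le> ennreal (mh_value u i (u i))"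
    for i
    using AE_seq_law_pos by eventually_elim (intro ennreal_leI mh_value_decseq_step, simp)
qed

lemma tail_moment_tendsto_0:
  assumes "(\<integral>\<^sup>+z. ennreal z \<partial>L) < \<infinity>"
  shows "(\<lambda>n. \<integral>\<^sup>+z. ennreal z * indicator {real n<..} z \<partial>L) \<longlonglongrightarrow> 0"
proof -
  have "(\<lambda>n. \<integral>\<^sup>+z. ennreal z * indicator {real n<..} z \<partial>L) \<longlonglongrightarrow> (\<integral>\<^sup>+z. 0 \<partial>L)"
  proof (rule nn_integral_dominated_convergence[where w = ennreal])
    show "AE z in L. (\<lambda>n. ennreal z * indicator {real n<..} z) \<longlonglongrightarrow> 0"
    proof (rule AE_I2)
      fix z :: real
      obtain n0 :: nat where "z \<le> real n0" using real_arch_simple by blast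
      then have "\<forall>\<^sub>F n in sequentially. ennreal z * indicator {real n<..} z = 0"
        by (auto simp: eventually_sequentially indicator_def intro!: exI[of _ n0])
      then show "(\<lambda>n. ennreal z * indicator {real n<..} z) \<longlonglongrightarrow> 0"
        by (rule tendsto_eventually)
    qed
  qed (use assms in \<open>auto simp: indicator_def intro: AE_I2\<close>)
  then show ?thesis by simp
qed

text \<open>Stationarity says that \<open>g\<close> integrates to 1 against the measure with density
  \<open>z\<close> relative to \<open>L\<close>. Both bounds integrate
  \<open>g x \<le> g y + e y\<close>: the first with \<open>y\<close> under that measure and
  \<open>x\<close> under \<open>L\<close>, the second with the roles exchanged.\<close>

lemma mean_final_value_bounds:
  assumes K: "1 \<le> K"
  defines "A \<equiv> \<integral>\<^sup>+z. ennreal (1 / z) \<partial>L"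
    and "\<zeta> \<equiv> \<integral>\<^sup>+z. ennreal z \<partial>L"
    and "\<rho> \<equiv> \<integral>\<^sup>+t. ennreal (1 - min 1 (t / K)) \<partial>L"
    and "\<tau> \<equiv> \<integral>\<^sup>+z. ennreal z * indicator {K<..} z \<partial>L"
    and "a \<equiv> \<lambda>i. \<integral>\<^sup>+u. ennreal (mh_value u i (u i)) \<partial>seq_law"
  shows "\<zeta> * a (Suc i) \<le> 1 + A * (\<tau> + \<zeta> * \<rho> ^ i)"
    and "1 \<le> \<zeta> * (a (Suc i) + A * (\<tau> + \<rho> ^ i))"
proof -
  define g where "g = mean_value (Suc i)"
  define e where "e y = A * (indicator {K<..} y + \<rho> ^ i)" for y
  have [measurable]: "g \<in> borel_measurable borel" "e \<in> borel_measurable borel"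
    by (simp_all add: g_def e_def[abs_def])
  have a: "a (Suc i) = (\<integral>\<^sup>+z. g z \<partial>L)"
    unfolding a_def g_def by (rule nn_integral_final_value)
  have weighted: "(\<integral>\<^sup>+z. ennreal z * g z \<partial>L) = 1"
    unfolding g_def by (rule nn_integral_weighted_mean_value)
  have diff: "g x \<le> g y + e y" if "0 < x" "0 < y" for x y
    using mean_value_diff_bound[OF that, of K i] K unfolding g_def e_def A_def \<rho>_def by simp

  have le: "\<zeta> * g x \<le> 1 + A * (\<tau> + \<zeta> * \<rho> ^ i)" if "0 < x" for x
  proof -
    have "\<zeta> * g x = (\<integral>\<^sup>+y. ennreal y * g x \<partial>L)"
      by (simp add: \<zeta>_def nn_integral_multc)
    also have "\<dots> \<le> (\<integral>\<^sup>+y. ennreal y * (g y + e y) \<partial>L)"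
      by (rule nn_integral_mono_AE, use pos in eventually_elim)
        (intro mult_left_mono diff that, auto)
    also have "\<dots> = (\<integral>\<^sup>+y. ennreal y * g y + (A * (ennreal y * indicator {K<..} y)
        + A * (ennreal y * \<rho> ^ i)) \<partial>L)"
      by (simp add: e_def distrib_left mult_ac)
    also have "\<dots> = 1 + A * (\<tau> + \<zeta> * \<rho> ^ i)"
      by (simp add: nn_integral_add nn_integral_cmult nn_integral_multc weighted \<tau>_def \<zeta>_def
          distrib_left)
    finally show ?thesis .
  qed
  have "\<zeta> * a (Suc i) = (\<integral>\<^sup>+x. \<zeta> * g x \<partial>L)"
    by (simp add: a nn_integral_cmult)
  also have "\<dots> \<le> (\<integral>\<^sup>+x. 1 + A * (\<tau> + \<zeta> * \<rho> ^ i) \<partial>L)"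
    by (rule nn_integral_mono_AE, use pos in eventually_elim) (rule le)
  finally show "\<zeta> * a (Suc i) \<le> 1 + A * (\<tau> + \<zeta> * \<rho> ^ i)"
    using emeasure_space_1 by simp

  have ge: "g x \<le> a (Suc i) + A * (\<tau> + \<rho> ^ i)" if "0 < x" for x
  proof -
    have "g x = (\<integral>\<^sup>+y. g x \<partial>L)" using emeasure_space_1 by simp
    also have "\<dots> \<le> (\<integral>\<^sup>+y. g y + (A * (ennreal y * indicator {K<..} y) + A * \<rho> ^ i) \<partial>L)"
    proof (rule nn_integral_mono_AE, use pos in eventually_elim)
      case (elim y)
      \<comment> \<open>Since \<open>K \<ge> 1\<close>, the probability of exceeding
        \<open>K\<close> is at most the tail moment \<open>\<tau>\<close>, so one tail term serves
        both bounds.\<close>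
      have "indicator {K<..} y \<le> ennreal y * indicator {K<..} y"
        using K by (auto simp: indicator_def)
      then have "A * indicator {K<..} y \<le> A * (ennreal y * indicator {K<..} y)"
        by (rule mult_left_mono) simp
      then have "g y + e y \<le> g y + (A * (ennreal y * indicator {K<..} y) + A * \<rho> ^ i)"
        unfolding e_def distrib_left by (intro add_mono) auto
      with diff[OF that elim] show ?case by (rule order_trans)
    qed
    also have "\<dots> = a (Suc i) + A * (\<tau> + \<rho> ^ i)"
      using emeasure_space_1
      by (simp add: nn_integral_add nn_integral_cmult a \<tau>_def distrib_left)
    finally show ?thesis .
  qed
  have "1 = (\<integral>\<^sup>+x. ennreal x * g x \<partial>L)" by (simp add: weighted)
  also have "\<dots> \<le> (\<integral>\<^sup>+x. ennreal x * (a (Suc i) + A * (\<tau> + \<rho> ^ i)) \<partial>L)"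
    by (rule nn_integral_mono_AE, use pos in eventually_elim) (intro mult_left_mono ge, auto)
  finally show "1 \<le> \<zeta> * (a (Suc i) + A * (\<tau> + \<rho> ^ i))"
    by (simp add: \<zeta>_def nn_integral_multc)
qed

lemma mean_final_value_tendsto:
  assumes "(\<integral>\<^sup>+z. ennreal z \<partial>L) = ennreal Z" "0 < Z" "(\<integral>\<^sup>+z. ennreal (1 / z) \<partial>L) < \<infinity>"
  shows "(\<lambda>i. \<integral>\<^sup>+u. ennreal (mh_value u i (u i)) \<partial>seq_law) \<longlonglongrightarrow> ennreal (1 / Z)"
proof -
  define a where "a i = (\<integral>\<^sup>+u. ennreal (mh_value u i (u i)) \<partial>seq_law)" for i
  define A where "A = (\<integral>\<^sup>+z. ennreal (1 / z) \<partial>L)"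
  define \<rho> where "\<rho> K = (\<integral>\<^sup>+t. ennreal (1 - min 1 (t / K)) \<partial>L)" for K :: real
  define \<tau> where "\<tau> n = (\<integral>\<^sup>+z. ennreal z * indicator {real n<..} z \<partial>L)" for n
  define c where "c = (INF i. a i)"
  have A: "A < top" using assms(3) by (simp add: A_def)
  have lim: "a \<longlonglongrightarrow> c"
    unfolding c_def by (rule LIMSEQ_INF) (unfold a_def, rule decseq_mean_final_value)
  then have lim': "(\<lambda>i. a (Suc i)) \<longlonglongrightarrow> c" by (rule LIMSEQ_Suc)
  have pow: "(\<lambda>i. \<rho> K ^ i) \<longlonglongrightarrow> 0" if "0 < K" for K
  proof -
    have "\<rho> K < 1" using mean_rejection_less_1[OF that] by (simp add: \<rho>_def)
    then obtain r where r: "\<rho> K = ennreal r" "0 \<le> r" "r < 1"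
      by (cases "\<rho> K") (auto simp: ennreal_less_one_iff)
    have "(\<lambda>i. ennreal (r ^ i)) \<longlonglongrightarrow> ennreal 0"
      by (intro tendsto_ennrealI LIMSEQ_realpow_zero r)
    then show ?thesis using r by (simp add: ennreal_power)
  qed
  \<comment> \<open>The limit in \<open>i\<close> is taken first, at a fixed truncation level
    \<open>n\<close>: the geometric term vanishes while the tail term stays.\<close>
  have bounds: "ennreal Z * c \<le> 1 + A * (\<tau> n + ennreal Z * 0)"
    "1 \<le> ennreal Z * (c + A * (\<tau> n + 0))" if "1 \<le> n" for n
  proof -
    have K: "1 \<le> real n" "0 < real n" using that by auto
    show "ennreal Z * c \<le> 1 + A * (\<tau> n + ennreal Z * 0)"
    proof (rule LIMSEQ_le)
      show "(\<lambda>i. ennreal Z * a (Suc i)) \<longlonglongrightarrow> ennreal Z * c"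
        by (intro ennreal_tendsto_cmult lim') simp
      show "(\<lambda>i. 1 + A * (\<tau> n + ennreal Z * \<rho> n ^ i)) \<longlonglongrightarrow> 1 + A * (\<tau> n + ennreal Z * 0)"
        by (intro tendsto_add tendsto_const ennreal_tendsto_cmult pow A K) simp
      show "\<exists>N. \<forall>i\<ge>N. ennreal Z * a (Suc i) \<le> 1 + A * (\<tau> n + ennreal Z * \<rho> n ^ i)"
        using mean_final_value_bounds(1)[OF K(1)]
        by (auto simp: a_def A_def \<rho>_def \<tau>_def assms(1))
    qed
    show "1 \<le> ennreal Z * (c + A * (\<tau> n + 0))"
    proof (rule LIMSEQ_le_const)
      show "(\<lambda>i. ennreal Z * (a (Suc i) + A * (\<tau> n + \<rho> n ^ i)))
          \<longlonglongrightarrow> ennreal Z * (c + A * (\<tau> n + 0))"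
        by (intro tendsto_add tendsto_const ennreal_tendsto_cmult pow lim' A K) simp
      show "\<exists>N. \<forall>i\<ge>N. 1 \<le> ennreal Z * (a (Suc i) + A * (\<tau> n + \<rho> n ^ i))"
        using mean_final_value_bounds(2)[OF K(1)]
        by (auto simp: a_def A_def \<rho>_def \<tau>_def assms(1))
    qed
  qed
  have \<tau>: "\<tau> \<longlonglongrightarrow> 0"
    unfolding \<tau>_def[abs_def] by (rule tail_moment_tendsto_0) (simp add: assms(1))
  \<comment> \<open>Now the truncation level tends to infinity. Finiteness of \<open>A\<close> makes
    multiplication by \<open>A\<close> continuous on \<open>ennreal\<close>.\<close>
  have "ennreal Z * c \<le> 1 + A * (0 + ennreal Z * 0)"
  proof (rule LIMSEQ_le_const)
    show "(\<lambda>n. 1 + A * (\<tau> n + ennreal Z * 0)) \<longlonglongrightarrow> 1 + A * (0 + ennreal Z * 0)"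
      by (intro tendsto_add tendsto_const ennreal_tendsto_cmult \<tau> A)
  qed (use bounds(1) in blast)
  moreover have "1 \<le> ennreal Z * (c + A * (0 + 0))"
  proof (rule LIMSEQ_le_const)
    show "(\<lambda>n. ennreal Z * (c + A * (\<tau> n + 0))) \<longlonglongrightarrow> ennreal Z * (c + A * (0 + 0))"
      by (intro tendsto_add tendsto_const ennreal_tendsto_cmult \<tau> A) simp
  qed (use bounds(2) in blast)
  ultimately have "ennreal Z * c = 1" by (intro antisym) simp_all
  then have "ennreal (1 / Z) * (ennreal Z * c) = ennreal (1 / Z)" by (simp only: mult_1_right)
  then have "c = ennreal (1 / Z)"
    using assms(2) by (simp add: mult.assoc[symmetric] ennreal_mult[symmetric])
  with lim show ?thesis by (simp add: a_def[abs_def])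
qed

text \<open>The means decrease from \<open>A\<close> at \<open>i = 0\<close> to the limit
  \<open>1 / Z\<close>, so their decrements telescope. The second claim ensures that
  \<open>ennreal (A - 1 / Z)\<close> is not truncated at 0.\<close>

lemma suminf_mean_decrements:
  assumes "(\<integral>\<^sup>+z. ennreal z \<partial>L) = ennreal Z" "0 < Z" "(\<integral>\<^sup>+z. ennreal (1 / z) \<partial>L) = ennreal A"
    "0 \<le> A"
  shows "(\<Sum>i. \<integral>\<^sup>+u. ennreal (mh_value u i (u i) - mh_value u (Suc i) (u (Suc i))) \<partial>seq_law)
    = ennreal (A - 1 / Z)"
    and "0 \<le> A - 1 / Z"
proof -
  define a where "a i = (\<integral>\<^sup>+u. ennreal (mh_value u i (u i)) \<partial>seq_law)" for i
  have dec: "decseq a" unfolding a_def[abs_def] by (rule decseq_mean_final_value)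
  have lim: "a \<longlonglongrightarrow> ennreal (1 / Z)"
    unfolding a_def[abs_def] using assms by (intro mean_final_value_tendsto) auto
  have a0: "a 0 = ennreal A"
    using nn_integral_rejections[where i = 0] assms(3) by (simp add: a_def)
  have fin: "a i < top" for i
    using decseqD[OF dec, of 0 i] a0 by (auto simp: less_top[symmetric] top_unique)
  define \<alpha> where "\<alpha> i = enn2real (a i)" for i
  have a: "a i = ennreal (\<alpha> i)" for i using fin[of i] by (simp add: \<alpha>_def)
  have \<alpha>: "0 \<le> \<alpha> i" for i by (simp add: \<alpha>_def)
  have dec': "\<alpha> (Suc i) \<le> \<alpha> i" for i
    using decseq_SucD[OF dec, of i] by (simp add: a \<alpha>)
  have lim': "\<alpha> \<longlonglongrightarrow> 1 / Z"
    using lim assms(2) unfolding a[abs_def] by (subst (asm) tendsto_ennreal_iff) (auto simp: \<alpha>)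
  have "\<alpha> 0 = A" using a0 assms(4) by (simp add: \<alpha>_def)
  moreover have "1 / Z \<le> \<alpha> 0"
    by (rule decseq_ge[OF decseq_SucI lim']) (rule dec')
  ultimately show "0 \<le> A - 1 / Z" by simp
  have "(\<integral>\<^sup>+u. ennreal (mh_value u i (u i) - mh_value u (Suc i) (u (Suc i))) \<partial>seq_law)
      = ennreal (\<alpha> i - \<alpha> (Suc i))" for i
  proof -
    have "(\<integral>\<^sup>+u. ennreal (mh_value u i (u i) - mh_value u (Suc i) (u (Suc i))) \<partial>seq_law)
        = (\<integral>\<^sup>+u. ennreal (mh_value u i (u i)) - ennreal (mh_value u (Suc i) (u (Suc i))) \<partial>seq_law)"
    proof (rule nn_integral_cong_AE, use AE_seq_law_pos in eventually_elim)
      case (elim u)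
      then have "0 \<le> mh_value u (Suc i) (u (Suc i))" by (intro mh_value_nonneg) auto
      then show ?case by (rule ennreal_minus[symmetric])
    qed
    also have "\<dots> = a i - a (Suc i)"
      unfolding a_def
    proof (rule nn_integral_diff)
      show "AE u in seq_law. ennreal (mh_value u (Suc i) (u (Suc i))) \<le> ennreal (mh_value u i (u i))"
        using AE_seq_law_pos by eventually_elim (intro ennreal_leI mh_value_decseq_step, simp)
      show "(\<integral>\<^sup>+u. ennreal (mh_value u (Suc i) (u (Suc i))) \<partial>seq_law) \<noteq> \<infinity>"
        using fin[of "Suc i"] unfolding a_def by auto
    qed measurable
    finally show ?thesis by (simp add: a ennreal_minus \<alpha>)
  qed
  then have "(\<Sum>i. \<integral>\<^sup>+u. ennreal (mh_value u i (u i) - mh_value u (Suc i) (u (Suc i))) \<partial>seq_law)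
      = (\<Sum>i. ennreal (\<alpha> i - \<alpha> (Suc i)))" by simp
  also have "\<dots> = ennreal (\<alpha> 0 - 1 / Z)"
    by (rule suminf_ennreal_eq[OF _ telescope_sums'[OF lim']]) (simp add: dec')
  finally show "(\<Sum>i. \<integral>\<^sup>+u. ennreal (mh_value u i (u i) - mh_value u (Suc i) (u (Suc i))) \<partial>seq_law)
      = ennreal (A - 1 / Z)" using \<open>\<alpha> 0 = A\<close> by simp
qed

end

section \<open>Reversal of an i.i.d. sequence at an independent time\<close>

lemma measurable_sequenceI:
  assumes "\<And>j. (\<lambda>x. f x j) \<in> measurable N M"
  shows "f \<in> measurable N (\<Pi>\<^sub>M j\<in>UNIV. M)"
  using measurable_PiM_single'[of UNIV "\<lambda>j x. f x j" N "\<lambda>_. M"] measurable_space[OF assms] assms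
  by (auto simp: PiE_def)

text \<open>Keeping the indices above \<open>n\<close> fixed makes the index map injective on all
  naturals, so that reversal acts on infinite sequences and preserves a product of identical
  laws.\<close>

definition reverse_prefix :: "nat \<Rightarrow> (nat \<Rightarrow> 'b) \<Rightarrow> nat \<Rightarrow> 'b" where
  "reverse_prefix n x j = x (if j \<le> n then n - j else j)"

lemma reverse_prefix_measurable [measurable]:
  "reverse_prefix n \<in> measurable (\<Pi>\<^sub>M i\<in>UNIV. M) (\<Pi>\<^sub>M i\<in>UNIV. M)"
  unfolding reverse_prefix_def by (rule measurable_sequenceI) simp

lemma distr_PiM_reverse_prefix:
  assumes "prob_space L"
  shows "distr (\<Pi>\<^sub>M i\<in>UNIV. L) (\<Pi>\<^sub>M i\<in>UNIV. L) (reverse_prefix n) = (\<Pi>\<^sub>M i\<in>UNIV. L)"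
proof -
  have "inj (\<lambda>j. if j \<le> n then n - j else j)"
    by (rule injI) (auto split: if_splits)
  then show ?thesis
    using distr_PiM_reindex[of UNIV "\<lambda>_. L" "\<lambda>j. if j \<le> n then n - j else j" UNIV] assms
    by (simp add: reverse_prefix_def[abs_def] restrict_UNIV)
qed

context prob_space
begin

text \<open>Events of the image sequence are events of the original one, by pulling back along the
  coordinatewise map, and independence passes to subfamilies.\<close>

lemma indep_of_sequence_compose:
  assumes indep: "indep_of_sequence M N \<mu> X"
    and X: "\<And>i. X i \<in> measurable M \<mu>" and f [measurable]: "f \<in> measurable \<mu> \<kappa>"
  shows "indep_of_sequence M N \<kappa> (\<lambda>i \<omega>. f (X i \<omega>))"
proof -
  define \<phi> where "\<phi> x i = f (x i)" for x and i :: nat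
  have [measurable]: "\<phi> \<in> measurable (\<Pi>\<^sub>M i\<in>UNIV. \<mu>) (\<Pi>\<^sub>M i\<in>UNIV. \<kappa>)"
    unfolding \<phi>_def by (rule measurable_sequenceI) measurable
  have eq: "(\<lambda>\<omega> i. f (X i \<omega>)) -` B \<inter> space M
      = (\<lambda>\<omega> i. X i \<omega>) -` (\<phi> -` B \<inter> space (\<Pi>\<^sub>M i\<in>UNIV. \<mu>)) \<inter> space M" for B
    using measurable_space[OF X] by (auto simp: \<phi>_def[abs_def] space_PiM PiE_def)
  have sets: "\<phi> -` B \<inter> space (\<Pi>\<^sub>M i\<in>UNIV. \<mu>) \<in> sets (\<Pi>\<^sub>M i\<in>UNIV. \<mu>)"
    if "B \<in> sets (\<Pi>\<^sub>M i\<in>UNIV. \<kappa>)" for B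
    by (rule measurable_sets[OF _ that]) measurable
  have "{(\<lambda>\<omega> i. f (X i \<omega>)) -` B \<inter> space M | B. B \<in> sets (\<Pi>\<^sub>M i\<in>UNIV. \<kappa>)}
      \<subseteq> {(\<lambda>\<omega> i. X i \<omega>) -` B \<inter> space M | B. B \<in> sets (\<Pi>\<^sub>M i\<in>UNIV. \<mu>)}"
  proof clarify
    fix B assume "B \<in> sets (\<Pi>\<^sub>M i\<in>(UNIV :: nat set). \<kappa>)"
    then show "\<exists>C. (\<lambda>\<omega> i. f (X i \<omega>)) -` B \<inter> space M = (\<lambda>\<omega> i. X i \<omega>) -` C \<inter> space M
        \<and> C \<in> sets (\<Pi>\<^sub>M i\<in>UNIV. \<mu>)"
      by (intro exI[of _ "\<phi> -` B \<inter> space (\<Pi>\<^sub>M i\<in>UNIV. \<mu>)"] conjI eq sets)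
  qed
  with indep show ?thesis
    unfolding indep_of_sequence_def indep_set_def
    by (elim indep_sets_mono_sets) (auto split: bool.split)
qed

text \<open>
  Reversal preserves the law of an i.i.d. sequence, so reading the sequence backwards from an
  independent random time gives again an i.i.d. sequence independent of that time.
\<close>

lemma nn_integral_reverse_prefix:
  fixes U :: "nat \<Rightarrow> 'a \<Rightarrow> 'b" and N :: "'a \<Rightarrow> nat"
  assumes U_indep: "indep_vars (\<lambda>_. \<kappa>) U UNIV"
    and U_law: "\<And>i. distr M \<kappa> (U i) = L"
    and N [measurable]: "N \<in> measurable M (count_space UNIV)"
    and N_indep: "indep_of_sequence M N \<kappa> U"
    and G: "G \<in> borel_measurable (\<Pi>\<^sub>M i\<in>UNIV. L)"
  shows "(\<integral>\<^sup>+\<omega>. indicator A (N \<omega>) * G (reverse_prefix (N \<omega>) (\<lambda>i. U i \<omega>)) \<partial>M)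
    = emeasure M (N -` A \<inter> space M) * (\<integral>\<^sup>+u. G u \<partial>(\<Pi>\<^sub>M i\<in>UNIV. L))"
proof -
  let ?S = "\<Pi>\<^sub>M i\<in>(UNIV :: nat set). L"
  have U [measurable]: "U i \<in> measurable M \<kappa>" for i
    using U_indep by (auto simp: indep_vars_def)
  have sets_L [measurable_cong]: "sets L = sets \<kappa>"
    using U_law[of 0] by (metis sets_distr)
  have L: "prob_space L"
    using prob_space_distr[OF U, of 0] U_law[of 0] by simp
  have sets_S: "sets ?S = sets (\<Pi>\<^sub>M i\<in>UNIV. \<kappa>)"
    by (intro sets_PiM_cong sets_L refl)
  define W where "W \<omega> = (\<lambda>i. U i \<omega>)" for \<omega>
  define V where "V \<omega> = reverse_prefix (N \<omega>) (W \<omega>)" for \<omega>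
  have W [measurable]: "W \<in> measurable M ?S"
    unfolding W_def by (rule measurable_sequenceI) measurable
  have [measurable]: "V \<in> measurable M ?S"
    unfolding V_def[abs_def] by (rule measurable_compose_countable) measurable
  have law: "distr M ?S W = ?S"
  proof -
    have "distr M (\<Pi>\<^sub>M i\<in>UNIV. \<kappa>) W = ?S"
      using U_indep indep_vars_iff_distr_eq_PiM[where I = UNIV and M' = "\<lambda>_. \<kappa>" and X = U]
      by (simp add: U_law W_def[abs_def] restrict_UNIV)
    then show ?thesis by (simp add: sets_S cong: distr_cong)
  qed
  have [measurable]: "N -` C \<inter> V -` B \<inter> space M \<in> sets M" if "B \<in> sets ?S" for B C
  proof -
    have "(N -` C \<inter> space M) \<inter> (V -` B \<inter> space M) \<in> sets M"
      using that by (intro sets.Int measurable_sets[of V M ?S] measurable_sets[OF N]) auto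
    then show ?thesis by (simp add: Int_ac)
  qed
  \<comment> \<open>On \<open>N = n\<close> the random reversal is the deterministic one, so
    independence applies to \<open>W\<close> and the fixed event \<open>C\<close>.\<close>
  have single: "emeasure M (N -` {n} \<inter> V -` B \<inter> space M)
      = emeasure M (N -` {n} \<inter> space M) * emeasure ?S B" if B: "B \<in> sets ?S" for n B
  proof -
    define C where "C = reverse_prefix n -` B \<inter> space ?S"
    have C: "C \<in> sets ?S" unfolding C_def by (rule measurable_sets[OF _ B]) measurable
    have "N -` {n} \<inter> V -` B \<inter> space M = (N -` {n} \<inter> space M) \<inter> (W -` C \<inter> space M)"
      using measurable_space[OF W] by (auto simp: V_def C_def)
    moreover have "prob ((N -` {n} \<inter> space M) \<inter> (W -` C \<inter> space M))
        = prob (N -` {n} \<inter> space M) * prob (W -` C \<inter> space M)"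
      using N_indep C unfolding indep_of_sequence_def W_def[symmetric] sets_S
      by (intro indep_setD) auto
    moreover have "emeasure M (W -` C \<inter> space M) = emeasure ?S B"
    proof -
      have "emeasure M (W -` C \<inter> space M) = emeasure (distr M ?S W) C"
        by (simp add: emeasure_distr C)
      also have "\<dots> = emeasure (distr ?S ?S (reverse_prefix n)) B"
        unfolding law by (simp add: emeasure_distr B C_def)
      finally show ?thesis by (simp add: distr_PiM_reverse_prefix L)
    qed
    ultimately show ?thesis
      by (simp add: emeasure_eq_measure ennreal_mult)
  qed
  have rect: "emeasure M (N -` A \<inter> V -` B \<inter> space M)
      = emeasure M (N -` A \<inter> space M) * emeasure ?S B" if B: "B \<in> sets ?S" for B
  proof -
    note [measurable] = B
    have "emeasure M (N -` A \<inter> V -` B \<inter> space M)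
        = emeasure M (\<Union>n\<in>A. N -` {n} \<inter> V -` B \<inter> space M)"
      by (rule arg_cong[where f = "emeasure M"]) auto
    also have "\<dots> = (\<integral>\<^sup>+n. emeasure M (N -` {n} \<inter> V -` B \<inter> space M) \<partial>count_space A)"
      by (rule emeasure_UN_countable) (auto simp: disjoint_family_on_def)
    also have "\<dots> = (\<integral>\<^sup>+n. emeasure M (N -` {n} \<inter> space M) \<partial>count_space A) * emeasure ?S B"
      by (simp add: single[OF B] nn_integral_multc)
    also have "(\<integral>\<^sup>+n. emeasure M (N -` {n} \<inter> space M) \<partial>count_space A)
        = emeasure M (\<Union>n\<in>A. N -` {n} \<inter> space M)"
      by (rule emeasure_UN_countable[symmetric]) (auto simp: disjoint_family_on_def)
    also have "(\<Union>n\<in>A. N -` {n} \<inter> space M) = N -` A \<inter> space M" by auto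
    finally show ?thesis .
  qed
  \<comment> \<open>Restricting \<open>M\<close> to the event \<open>N \<in> A\<close> by a density
    turns the rectangle formula into an equality of measures, from which the integral formula
    follows by change of variables.\<close>
  let ?D = "density M (\<lambda>\<omega>. indicator A (N \<omega>))"
  have distr: "distr ?D ?S V = scale_measure (emeasure M (N -` A \<inter> space M)) ?S"
  proof (rule measure_eqI)
    fix B assume "B \<in> sets (distr ?D ?S V)"
    then have B [measurable]: "B \<in> sets ?S" by simp
    have "emeasure (distr ?D ?S V) B
        = (\<integral>\<^sup>+\<omega>. indicator A (N \<omega>) * indicator (V -` B \<inter> space M) \<omega> \<partial>M)"
      by (simp add: emeasure_distr emeasure_density)
    also have "\<dots> = (\<integral>\<^sup>+\<omega>. indicator (N -` A \<inter> V -` B \<inter> space M) \<omega> \<partial>M)"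
      by (rule nn_integral_cong) (auto simp: indicator_def)
    also have "\<dots> = emeasure M (N -` A \<inter> V -` B \<inter> space M)"
      by (rule nn_integral_indicator) measurable
    finally show "emeasure (distr ?D ?S V) B
        = emeasure (scale_measure (emeasure M (N -` A \<inter> space M)) ?S) B"
      by (simp add: rect[OF B])
  qed simp
  have "(\<integral>\<^sup>+\<omega>. indicator A (N \<omega>) * G (V \<omega>) \<partial>M) = (\<integral>\<^sup>+\<omega>. G (V \<omega>) \<partial>?D)"
    using G by (subst nn_integral_density) auto
  also have "\<dots> = (\<integral>\<^sup>+u. G u \<partial>(distr ?D ?S V))"
    using G by (subst nn_integral_distr) auto
  also have "\<dots> = emeasure M (N -` A \<inter> space M) * (\<integral>\<^sup>+u. G u \<partial>?S)"
    unfolding distr using G by (rule nn_integral_scale_measure)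
  finally show ?thesis by (simp add: V_def W_def)
qed

end

section \<open>The estimator as a function of the reversed weights, and its mean\<close>

theorem proposition4:
  fixes \<mu> :: "'x measure"
    and Q Pstar :: "'x \<Rightarrow> real"
    and Z :: real
    and M :: "'a measure"
    and N :: "'a \<Rightarrow> nat"
    and X :: "nat \<Rightarrow> 'a \<Rightarrow> 'x"
    and S :: "'a \<Rightarrow> real"
  assumes Q_integrable: "integrable \<mu> Q"
    and Q_normalized: "(\<integral>x. Q x \<partial>\<mu>) = 1"
    and Q_pos: "\<And>x. x \<in> space \<mu> \<Longrightarrow> Q x > 0"
    and Pstar_integrable: "integrable \<mu> Pstar"
    and Z_eq: "Z = (\<integral>x. Pstar x \<partial>\<mu>)"
    and Z_pos: "0 < Z"
    and Pstar_pos: "\<And>x. x \<in> space \<mu> \<Longrightarrow> Pstar x > 0"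
    and finite_expectation: "integrable (density \<mu> (\<lambda>x. ennreal (Q x))) (\<lambda>x. Q x / Pstar x)"
    and M: "prob_space M"
    and N_measurable: "N \<in> measurable M (count_space UNIV)"
    and N_tail: "\<And>i. measure M {\<omega> \<in> space M. N \<omega> \<ge> i} > 0"
    and X_law: "\<And>i. distributed M \<mu> (X i) (\<lambda>x. ennreal (Q x))"
    and X_indep: "prob_space.indep_vars M (\<lambda>_. \<mu>) X UNIV"
    and N_indep: "indep_of_sequence M N \<mu> X"
    and S_output: "\<And>\<omega>. \<omega> \<in> space M \<Longrightarrow>
      rb_output (\<lambda>i. measure M {\<omega>' \<in> space M. N \<omega>' \<ge> i}) (N \<omega>)
        (\<lambda>i. importance_weight Pstar Q (X i \<omega>)) (S \<omega>)"
  shows "integrable M S \<and> (\<integral>\<omega>. S \<omega> \<partial>M) = 1 / Z"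
proof -
  interpret prob_space M by (rule M)
  define w where "w = importance_weight Pstar Q"
  define U where "U i \<omega> = w (X i \<omega>)" for i \<omega>
  \<comment> \<open>The chain sees a state only through its weight, so the state space can be
    replaced by the law of the weight under the proposal density.\<close>
  define L where "L = distr (density \<mu> (\<lambda>x. ennreal (Q x))) borel w"
  note [measurable] = N_measurable
  have [measurable]: "Q \<in> borel_measurable \<mu>" "Pstar \<in> borel_measurable \<mu>"
    using Q_integrable Pstar_integrable by auto
  have w [measurable]: "w \<in> borel_measurable \<mu>"
    unfolding w_def importance_weight_def[abs_def] by measurable
  have X [measurable]: "X i \<in> measurable M \<mu>" for i
    using X_law by (simp add: distributed_def)
  have w_pos: "0 < w x" if "x \<in> space \<mu>" for x
    using Q_pos[OF that] Pstar_pos[OF that] by (simp add: w_def importance_weight_def)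
  have U_pos: "0 < U i \<omega>" if "\<omega> \<in> space M" for i \<omega>
    using measurable_space[OF X that] by (simp add: U_def w_pos)
  have U [measurable]: "U i \<in> borel_measurable M" for i
    unfolding U_def[abs_def] by measurable
  have U_law: "distr M borel (U i) = L" for i
  proof -
    have "distr M borel (U i) = distr (distr M \<mu> (X i)) borel w"
      by (subst distr_distr) (auto simp: U_def[abs_def] comp_def)
    then show ?thesis using X_law[of i] by (simp add: L_def distributed_def)
  qed
  have U_indep: "indep_vars (\<lambda>_. borel) U UNIV"
    using indep_vars_compose2[OF X_indep w] by (simp add: U_def[abs_def])
  have N_indep': "indep_of_sequence M N borel U"
    using indep_of_sequence_compose[OF N_indep X w] by (simp add: U_def[abs_def])

  have "prob_space L" using prob_space_distr[OF U, of 0] by (simp add: U_law)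
  then interpret L: prob_space L .
  interpret weight_law L
  proof
    show "sets L = sets borel" by (simp add: L_def)
    show "AE z in L. 0 < z"
      unfolding L_def by (subst AE_distr_iff) (auto simp: w_pos)
  qed

  have Z: "(\<integral>\<^sup>+z. ennreal z \<partial>L) = ennreal Z"
  proof -
    have "(\<integral>\<^sup>+z. ennreal z \<partial>L) = (\<integral>\<^sup>+x. ennreal (Q x) * ennreal (w x) \<partial>\<mu>)"
      by (simp add: L_def nn_integral_distr nn_integral_density)
    also have "\<dots> = (\<integral>\<^sup>+x. ennreal (Pstar x) \<partial>\<mu>)"
    proof (rule nn_integral_cong)
      fix x assume x: "x \<in> space \<mu>"
      have "Q x * w x = Pstar x" using Q_pos[OF x] by (simp add: w_def importance_weight_def)
      then show "ennreal (Q x) * ennreal (w x) = ennreal (Pstar x)"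
        using Q_pos[OF x] by (simp add: ennreal_mult'[symmetric])
    qed
    also have "\<dots> = ennreal Z"
      unfolding Z_eq using Pstar_pos
      by (intro nn_integral_eq_integral Pstar_integrable AE_I2) (auto intro: less_imp_le)
    finally show ?thesis .
  qed
  define A where "A = (\<integral>x. Q x / Pstar x \<partial>(density \<mu> (\<lambda>x. ennreal (Q x))))"
  have ratio_nonneg: "AE x in density \<mu> (\<lambda>x. ennreal (Q x)). 0 \<le> Q x / Pstar x"
    using Q_pos Pstar_pos by (intro AE_I2) (auto intro!: divide_nonneg_pos less_imp_le)
  have A: "(\<integral>\<^sup>+z. ennreal (1 / z) \<partial>L) = ennreal A"
  proof -
    have "(\<integral>\<^sup>+z. ennreal (1 / z) \<partial>L)
        = (\<integral>\<^sup>+x. ennreal (Q x / Pstar x) \<partial>(density \<mu> (\<lambda>x. ennreal (Q x))))"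
      by (simp add: L_def nn_integral_distr) (simp add: w_def importance_weight_def)
    also have "\<dots> = ennreal A"
      unfolding A_def by (rule nn_integral_eq_integral[OF finite_expectation ratio_nonneg])
    finally show ?thesis .
  qed
  have A_nonneg: "0 \<le> A" unfolding A_def by (rule integral_nonneg_AE[OF ratio_nonneg])

  define V where "V \<omega> = reverse_prefix (N \<omega>) (\<lambda>i. U i \<omega>)" for \<omega>
  define t where "t i = measure M {\<omega> \<in> space M. N \<omega> \<ge> i}" for i
  define D where "D i u = mh_value u i (u i) - mh_value u (Suc i) (u (Suc i))"
    for i and u :: "nat \<Rightarrow> real"
  \<comment> \<open>\<open>R\<close> is the correction sum with its sign reversed, hence
    nonnegative; the step from \<open>i\<close> to \<open>i + 1\<close> is paired with
    \<open>t (Suc i)\<close>.\<close>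
  define R where "R \<omega> = (\<Sum>i<N \<omega>. D i (V \<omega>) / t (Suc i))" for \<omega>
  have t_pos: "0 < t i" for i using N_tail by (simp add: t_def)
  have [measurable]: "(\<lambda>\<omega>. V \<omega> j) \<in> borel_measurable M" for j
    unfolding V_def reverse_prefix_def
    by (rule measurable_compose_countable[OF _ N_measurable]) measurable
  have D [measurable]: "D i \<in> borel_measurable seq_law" for i
    unfolding D_def[abs_def] by measurable
  have [measurable]: "V \<in> measurable M seq_law"
    by (rule measurable_sequenceI) measurable
  have [measurable]: "R \<in> borel_measurable M"
    unfolding R_def[abs_def]
    by (rule measurable_compose_countable[OF _ N_measurable]) measurable
  have V_pos: "0 < V \<omega> j" if "\<omega> \<in> space M" for \<omega> j
    using U_pos[OF that] by (simp add: V_def reverse_prefix_def)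
  have D_nonneg: "0 \<le> D i (V \<omega>)" if "\<omega> \<in> space M" for i \<omega>
    using mh_value_decseq_step[of "V \<omega>" i] V_pos[OF that] by (simp add: D_def)
  have R_nonneg: "0 \<le> R \<omega>" if "\<omega> \<in> space M" for \<omega>
    unfolding R_def using D_nonneg[OF that] t_pos by (intro sum_nonneg) (simp add: less_imp_le)

  \<comment> \<open>Every admissible output has this value, which also supplies the measurability of
    \<open>S\<close>.\<close>
  have S_eq: "S \<omega> = 1 / V \<omega> 0 - R \<omega>" if \<omega>: "\<omega> \<in> space M" for \<omega>
  proof -
    define n where "n = N \<omega>"
    \<comment> \<open>\<open>v\<close> has the form that \<open>rb_run_eq_mh_value\<close> requires
      at every \<open>j\<close>. Beyond \<open>n\<close>, truncated subtraction makes it constant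
      while \<open>reverse_prefix\<close> keeps the index, so it is matched with \<open>V\<close>
      only up to \<open>n\<close>, which is all that is read.\<close>
    define v where "v j = U (n - j) \<omega>" for j
    obtain Y where run: "rb_run n (\<lambda>i. U i \<omega>) Y"
      and S: "S \<omega> = 1 / U n \<omega> + (\<Sum>i=1..n. (Y i - Y (i - 1)) / t i)"
      using S_output[OF \<omega>] by (auto simp: rb_output_def n_def U_def w_def t_def)
    have Y: "Y i = mh_value (V \<omega>) i (V \<omega> i)" if "i \<le> n" for i
    proof -
      have eq: "v j = V \<omega> j" if "j \<le> n" for j
        using that by (simp add: v_def V_def reverse_prefix_def n_def)
      have "Y i = mh_value v i (v i)"
        using that U_pos[OF \<omega>] by (intro rb_run_eq_mh_value[OF run]) (auto simp: v_def)
      also have "\<dots> = mh_value (V \<omega>) i (V \<omega> i)"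
        using that eq mh_value_cong[of i v "V \<omega>"] by simp
      finally show ?thesis .
    qed
    have "(\<Sum>i=1..n. (Y i - Y (i - 1)) / t i) = (\<Sum>i<n. (Y (Suc i) - Y i) / t (Suc i))"
      by (rule sum.reindex_bij_witness[of _ Suc "\<lambda>i. i - 1"]) auto
    also have "\<dots> = (\<Sum>i<n. - (D i (V \<omega>) / t (Suc i)))"
      by (rule sum.cong) (auto simp: D_def Y minus_divide_left simp del: mh_value.simps)
    also have "\<dots> = - R \<omega>" by (simp add: sum_negf R_def n_def)
    finally show ?thesis
      by (simp add: S V_def reverse_prefix_def n_def)
  qed

  have reversed: "(\<integral>\<^sup>+\<omega>. indicator B (N \<omega>) * G (V \<omega>) \<partial>M)
      = emeasure M (N -` B \<inter> space M) * (\<integral>\<^sup>+u. G u \<partial>seq_law)"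
    if "G \<in> borel_measurable seq_law" for B G
    unfolding V_def
    by (rule nn_integral_reverse_prefix[OF U_indep U_law N_measurable N_indep' that])

  have nn_V0: "(\<integral>\<^sup>+\<omega>. ennreal (1 / V \<omega> 0) \<partial>M) = ennreal A"
    using reversed[of "\<lambda>u. ennreal (1 / u 0)" UNIV] nn_integral_rejections[where i = 0]
    by (simp add: A emeasure_space_1)
  \<comment> \<open>The event \<open>N \<ge> Suc i\<close> is independent of the reversed weights,
    so its probability cancels the denominator exactly.\<close>
  have nn_D: "(\<integral>\<^sup>+\<omega>. indicator {Suc i..} (N \<omega>) * ennreal (D i (V \<omega>) / t (Suc i)) \<partial>M)
      = (\<integral>\<^sup>+u. ennreal (D i u) \<partial>seq_law)" for i
  proof -
    have "(\<integral>\<^sup>+\<omega>. indicator {Suc i..} (N \<omega>) * ennreal (D i (V \<omega>) / t (Suc i)) \<partial>M)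
        = emeasure M (N -` {Suc i..} \<inter> space M) * (\<integral>\<^sup>+u. ennreal (D i u / t (Suc i)) \<partial>seq_law)"
      by (rule reversed) measurable
    also have "N -` {Suc i..} \<inter> space M = {\<omega> \<in> space M. N \<omega> \<ge> Suc i}" by auto
    also have "emeasure M \<dots> = ennreal (t (Suc i))" by (simp add: emeasure_eq_measure t_def)
    also have "(\<integral>\<^sup>+u. ennreal (D i u / t (Suc i)) \<partial>seq_law)
        = (\<integral>\<^sup>+u. ennreal (1 / t (Suc i)) * ennreal (D i u) \<partial>seq_law)"
      using t_pos[of "Suc i"] by (simp add: ennreal_mult'[symmetric])
    also have "\<dots> = ennreal (1 / t (Suc i)) * (\<integral>\<^sup>+u. ennreal (D i u) \<partial>seq_law)"
      by (rule nn_integral_cmult) measurable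
    also have "ennreal (t (Suc i)) * \<dots> = (\<integral>\<^sup>+u. ennreal (D i u) \<partial>seq_law)"
      using t_pos[of "Suc i"] by (simp add: mult.assoc[symmetric] ennreal_mult[symmetric])
    finally show ?thesis .
  qed
  \<comment> \<open>Indicators turn the sum of random length into a series of nonnegative terms, so
    that sum and mean can be exchanged.\<close>
  have "(\<integral>\<^sup>+\<omega>. ennreal (R \<omega>) \<partial>M)
      = (\<integral>\<^sup>+\<omega>. (\<Sum>i. indicator {Suc i..} (N \<omega>) * ennreal (D i (V \<omega>) / t (Suc i))) \<partial>M)"
  proof (rule nn_integral_cong)
    fix \<omega> assume \<omega>: "\<omega> \<in> space M"
    have "ennreal (R \<omega>) = (\<Sum>i<N \<omega>. ennreal (D i (V \<omega>) / t (Suc i)))"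
      unfolding R_def using D_nonneg[OF \<omega>] t_pos
      by (intro sum_ennreal[symmetric]) (simp add: less_imp_le)
    also have "\<dots> = (\<Sum>i<N \<omega>. indicator {Suc i..} (N \<omega>) * ennreal (D i (V \<omega>) / t (Suc i)))"
      by (rule sum.cong) auto
    also have "\<dots> = (\<Sum>i. indicator {Suc i..} (N \<omega>) * ennreal (D i (V \<omega>) / t (Suc i)))"
      by (rule suminf_finite[symmetric]) auto
    finally show "ennreal (R \<omega>)
        = (\<Sum>i. indicator {Suc i..} (N \<omega>) * ennreal (D i (V \<omega>) / t (Suc i)))" .
  qed
  also have "\<dots> = (\<Sum>i. \<integral>\<^sup>+\<omega>. indicator {Suc i..} (N \<omega>) * ennreal (D i (V \<omega>) / t (Suc i)) \<partial>M)"
  proof (rule nn_integral_suminf)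
    fix i
    have "(\<lambda>\<omega>. D i (V \<omega>)) \<in> borel_measurable M"
      by (rule measurable_compose[OF _ D]) measurable
    moreover have "(\<lambda>\<omega>. indicator {Suc i..} (N \<omega>) :: ennreal) \<in> borel_measurable M"
      by (rule measurable_compose[OF N_measurable]) simp
    ultimately show "(\<lambda>\<omega>. indicator {Suc i..} (N \<omega>) * ennreal (D i (V \<omega>) / t (Suc i)))
        \<in> borel_measurable M"
      by (intro borel_measurable_times_ennreal measurable_compose[OF _ measurable_ennreal]
          borel_measurable_divide) simp_all
  qed
  also have "\<dots> = (\<Sum>i. \<integral>\<^sup>+u. ennreal (D i u) \<partial>seq_law)"
    by (simp only: nn_D)
  also have "\<dots> = ennreal (A - 1 / Z)"
    unfolding D_def by (rule suminf_mean_decrements(1)[OF Z Z_pos A A_nonneg])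
  finally have nn_R: "(\<integral>\<^sup>+\<omega>. ennreal (R \<omega>) \<partial>M) = ennreal (A - 1 / Z)" .

  have R_AE: "AE \<omega> in M. 0 \<le> R \<omega>" by (rule AE_I2) (rule R_nonneg)
  have V0_AE: "AE \<omega> in M. 0 \<le> 1 / V \<omega> 0"
    by (rule AE_I2) (intro divide_nonneg_pos V_pos, simp_all)
  have V0 [measurable]: "(\<lambda>\<omega>. 1 / V \<omega> 0) \<in> borel_measurable M" by measurable
  have R_int: "integrable M R"
    by (rule integrableI_nn_integral_finite[OF _ R_AE nn_R]) measurable
  have V0_int: "integrable M (\<lambda>\<omega>. 1 / V \<omega> 0)"
    by (rule integrableI_nn_integral_finite[OF V0 V0_AE nn_V0])
  have "integral\<^sup>L M R = A - 1 / Z"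
    using suminf_mean_decrements(2)[OF Z Z_pos A A_nonneg]
    by (subst integral_eq_nn_integral[OF _ R_AE]) (simp_all only: nn_R enn2real_ennreal, measurable)
  moreover have "(\<integral>\<omega>. 1 / V \<omega> 0 \<partial>M) = A"
    by (simp only: integral_eq_nn_integral[OF V0 V0_AE] nn_V0 enn2real_ennreal[OF A_nonneg])
  \<comment> \<open>The mean of the initial term is \<open>A\<close> and that of the corrections is
    \<open>A - 1 / Z\<close>, so \<open>A\<close> cancels.\<close>
  ultimately have "(\<integral>\<omega>. 1 / V \<omega> 0 - R \<omega> \<partial>M) = 1 / Z"
    using R_int V0_int by (simp add: Bochner_Integration.integral_diff)
  moreover have "integrable M (\<lambda>\<omega>. 1 / V \<omega> 0 - R \<omega>)"
    using R_int V0_int by (rule Bochner_Integration.integrable_diff[rotated])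
  ultimately show ?thesis
    using S_eq by (simp cong: Bochner_Integration.integrable_cong Bochner_Integration.integral_cong)
qed

end
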